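(* Let $(\mathcal{M},d)$ be a metric space in which $d(x,y)\in[1,\Delta]$ for all distinct $x,y\in\mathcal{M}$, and let $\varepsilon>0$. There is a deterministic expiration-streaming algorithm that stores $\mathcal{O}((1/\varepsilon)\log\Delta)$ words and maintains a $(3+\varepsilon)$-approximation of the diameter of the set of active items: at any query time $t$ it can report a value $r$ with $r\le \mathrm{diam}(X_t)\le(3+\varepsilon)r$, where $X_t$ is the set of items active at time $t$ and $\mathrm{diam}(X)=\max\{d(x,y): x,y\in X\}$.
   Context: Expiration streaming model: the input is a sequence of items $x_1,\dots,x_n$; each item $x$ consists of a data point $p(x)$ (here a point of $\mathcal{M}$), an integer insertion time $S(x)>0$ and an expiration time $E(x)>S(x)$ (possibly $E(x)=\infty$), with $S(x_1)\le\dots\le S(x_n)$. An item $x$ is active at time $t$ if $S(x)\le t<E(x)$. Queries at an arbitrary time $t$ (unknown in advance) are evaluated on the items active at time $t$. The algorithm sees each item (with its insertion and expiration times) once when it arrives. Space is measured in machine words, where a word can store one point of $\mathcal{M}$, one time value, or a counter in the range $[\mathrm{poly}(n)]$.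
   Formalization: The space bound is O(max(1, log Δ / min(1,ε))) words, not O((1/ε) log Δ): the literal bound fails with an absolute constant, e.g. for Δ = 1 it allows no memory, and for large ε it is too small. For ε ≤ 1 and log Δ ≥ ε the two agree. *)

theory Defs
  imports "HOL-Analysis.Analysis"
begin

text \<open>
  Expiration times and query times are not restricted to integers; \<open>\<infinity>\<close> is the expiration time of
  an item that never expires.
\<close>

record 'a item =
  point :: 'a
  ins :: int
  expir :: ereal

definition valid_stream :: "'a set \<Rightarrow> 'a item list \<Rightarrow> bool" where
  "valid_stream M xs \<longleftrightarrow>
     (\<forall>x\<in>set xs. point x \<in> M \<and> 0 < ins x \<and> ereal (of_int (ins x)) < expir x) \<and>
     sorted (map ins xs)"

definition is_active :: "real \<Rightarrow> 'a item \<Rightarrow> bool" where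
  "is_active t x \<longleftrightarrow> of_int (ins x) \<le> t \<and> ereal t < expir x"

definition active_points :: "'a item list \<Rightarrow> real \<Rightarrow> 'a set" where
  "active_points xs t = point ` {x \<in> set xs. is_active t x}"

text \<open>
  The diameter of a finite set of points. As for \<^const>\<open>diameter\<close>, the empty set has diameter 0.
\<close>

definition diam :: "('a \<Rightarrow> 'a \<Rightarrow> real) \<Rightarrow> 'a set \<Rightarrow> real" where
  "diam d X = (if X = {} then 0 else Max {d x y | x y. x \<in> X \<and> y \<in> X})"

datatype 'a mword = Point 'a | Time ereal | Counter nat

text \<open>
  What a word may contain after the items \<open>xs\<close> have been read. Points and times must have occurred
  in the stream, and counters are at most polynomial in the number of items (the shift by 2 only
  matters for streams of length 0 and 1). Without these restrictions the space measure would be void: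
  a single unbounded number, or a single point of an infinite space, can encode the whole stream.
\<close>

fun storable :: "nat \<Rightarrow> 'a item list \<Rightarrow> 'a mword \<Rightarrow> bool" where
  "storable c xs (Point p) \<longleftrightarrow> p \<in> point ` set xs"
| "storable c xs (Time s) \<longleftrightarrow> s \<in> (\<lambda>x. ereal (of_int (ins x))) ` set xs \<union> expir ` set xs"
| "storable c xs (Counter k) \<longleftrightarrow> k \<le> (length xs + 2) ^ c"

text \<open>
  A deterministic streaming algorithm. Its only state between two arrivals is a list of words, so
  that the length of this list is the space used; queries see the query time and the memory only.
\<close>

record 'a streaming_alg =
  init :: "'a mword list"
  update :: "'a item \<Rightarrow> 'a mword list \<Rightarrow> 'a mword list"
  query :: "real \<Rightarrow> 'a mword list \<Rightarrow> real"

definition memory :: "'a streaming_alg \<Rightarrow> 'a item list \<Rightarrow> 'a mword list" where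
  "memory A xs = fold (update A) xs (init A)"

text \<open>
  Every prefix of a valid stream is a valid stream, so this bounds the memory at all times, and the
  range of the counters in terms of the number of items read so far.
\<close>

definition uses_at_most_words :: "'a set \<Rightarrow> nat \<Rightarrow> real \<Rightarrow> 'a streaming_alg \<Rightarrow> bool" where
  "uses_at_most_words M c s A \<longleftrightarrow>
     (\<forall>xs. valid_stream M xs \<longrightarrow>
        real (length (memory A xs)) \<le> s \<and> (\<forall>w\<in>set (memory A xs). storable c xs w))"

text \<open>
  At time \<open>t\<close> the algorithm has read exactly the items inserted up to time \<open>t\<close>, which form a prefix
  of the stream.
\<close>

definition answer :: "'a streaming_alg \<Rightarrow> 'a item list \<Rightarrow> real \<Rightarrow> real" where
  "answer A xs t = query A t (memory A (filter (\<lambda>x. of_int (ins x) \<le> t) xs))"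

definition maintains_diameter_approx ::
    "'a set \<Rightarrow> ('a \<Rightarrow> 'a \<Rightarrow> real) \<Rightarrow> real \<Rightarrow> 'a streaming_alg \<Rightarrow> bool" where
  "maintains_diameter_approx M d \<alpha> A \<longleftrightarrow>
     (\<forall>xs t. valid_stream M xs \<longrightarrow>
        answer A xs t \<le> diam d (active_points xs t) \<and>
        diam d (active_points xs t) \<le> \<alpha> * answer A xs t)"

text \<open>
  Meaning of the bound \<open>O((1/\<epsilon>) log \<Delta>)\<close>. A bound \<open>C * (1/\<epsilon>) * ln \<Delta>\<close> with an absolute constant \<open>C\<close> over
  the whole range \<open>\<epsilon> > 0\<close>, \<open>\<Delta> \<ge> 1\<close> is unattainable: it tends to 0 for \<open>\<Delta> \<rightarrow> 1\<close> or \<open>\<epsilon> \<rightarrow> \<infinity>\<close>, whereas the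
  algorithm has to keep at least one word, and for large \<open>\<epsilon>\<close> about \<open>ln \<Delta> / ln (1 + \<epsilon>)\<close> scales of
  distances have to be told apart. Hence the number of words is measured as at least 1, and an \<open>\<epsilon>\<close>
  above 1 is charged like \<open>\<epsilon> = 1\<close>. For \<open>\<epsilon> \<le> 1\<close> and \<open>ln \<Delta> \<ge> \<epsilon>\<close> this is \<open>(1/\<epsilon>) * ln \<Delta>\<close> itself.
\<close>

definition space_bound :: "real \<Rightarrow> real \<Rightarrow> real" where
  "space_bound \<epsilon> \<Delta> = max 1 (1 / min 1 \<epsilon> * ln \<Delta>)"

end

theory Submission
  imports Defs
begin

text \<open>
  For a threshold \<open>\<gamma>\<close>, call two points far if their distance is at least \<open>\<gamma>\<close>. Keep a centre \<open>c\<close>, the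
  item \<open>m\<close> that expires last, and an alarm time \<open>s\<close> such that a far pair is active before \<open>s\<close>, while
  the items surviving \<open>s\<close> are pairwise within \<open>3\<gamma>\<close>: each is near \<open>c\<close>, or expires no later than \<open>c\<close>
  and is within \<open>2\<gamma>\<close> of it. An item \<open>x\<close> far from \<open>c\<close> raises the alarm to the time when the first of
  the two expires. If that is \<open>c\<close>, all other survivors are near \<open>c\<close>. In this case, if \<open>x\<close> is near \<open>m\<close>,
  then \<open>m\<close> becomes the centre: it outlives all earlier items, which are within \<open>2\<gamma>\<close> of it. If \<open>x\<close> is
  far from \<open>m\<close> as well, the alarm can be raised further, past the end of \<open>x\<close> or of all earlier items.
  Running this for the thresholds \<open>(1 + \<epsilon>/3)^i\<close> between 1 and \<open>\<Delta>\<close> gives the algorithm.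
\<close>

section \<open>The summary for one threshold and its invariant\<close>

datatype 'a summary =
  Summary (centre: 'a) (centre_expir: ereal) (latest: 'a) (latest_expir: ereal) (alarm: ereal)

text \<open>The insertion time serves as an alarm that is off: it is storable, and no query after
  the arrival of \<open>x\<close> precedes it.\<close>

fun start :: "'a item \<Rightarrow> 'a summary" where
  "start x = Summary (point x) (expir x) (point x) (expir x) (ereal (of_int (ins x)))"

fun step :: "('a \<Rightarrow> 'a \<Rightarrow> real) \<Rightarrow> real \<Rightarrow> 'a item \<Rightarrow> 'a summary \<Rightarrow> 'a summary" where
  "step d \<gamma> x (Summary c ec m em s) =
     (let (m', em') = if em < expir x then (point x, expir x) else (m, em) in
      if d (point x) c < \<gamma> then Summary c ec m' em' s
      else if expir x \<le> ec \<or> (\<gamma> \<le> d (point x) m \<and> expir x \<le> em)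
        then Summary c ec m em (max s (expir x))
      else if d (point x) m < \<gamma> then Summary m em m' em' (max s ec)
      else Summary (point x) (expir x) (point x) (expir x) (max s em))"

text \<open>In the first case the alarm is off, since queries come after insertions. In the second,
  a far pair is active from the arrival of both its members until \<open>s\<close>.\<close>

definition sound_alarm :: "('a \<Rightarrow> 'a \<Rightarrow> real) \<Rightarrow> real \<Rightarrow> 'a item set \<Rightarrow> ereal \<Rightarrow> bool" where
  "sound_alarm d \<gamma> X s \<longleftrightarrow>
     s \<in> (\<lambda>x. ereal (of_int (ins x))) ` X \<or>
     (\<exists>p\<in>X. \<exists>q\<in>X. \<gamma> \<le> d (point p) (point q) \<and> s = min (expir p) (expir q))"

definition stored_item :: "'a item set \<Rightarrow> 'a \<Rightarrow> ereal \<Rightarrow> bool" where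
  "stored_item X c e \<longleftrightarrow> (\<exists>x\<in>X. point x = c \<and> expir x = e)"

text \<open>
  The second bound \<open>\<delta>\<close> is needed for the scale \<open>\<gamma> = 1\<close>, where near points coincide, so that \<open>\<delta> = 0\<close>.
  At all other scales \<open>\<delta> = \<gamma>\<close>.
\<close>

definition summarizes ::
    "('a \<Rightarrow> 'a \<Rightarrow> real) \<Rightarrow> real \<Rightarrow> real \<Rightarrow> 'a item set \<Rightarrow> 'a summary \<Rightarrow> bool" where
  "summarizes d \<gamma> \<delta> X S \<longleftrightarrow>
     stored_item X (centre S) (centre_expir S) \<and>
     stored_item X (latest S) (latest_expir S) \<and>
     (\<forall>p\<in>X. expir p \<le> latest_expir S) \<and>
     sound_alarm d \<gamma> X (alarm S) \<and>
     (\<forall>p\<in>X. alarm S < expir p \<longrightarrow> d (point p) (centre S) \<le> 2 * \<delta> \<and>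
        (expir p \<le> centre_expir S \<or> d (point p) (centre S) \<le> \<delta>)) \<and>
     (\<forall>p\<in>X. \<forall>q\<in>X. alarm S < expir p \<and> alarm S < expir q \<longrightarrow>
        d (point p) (point q) \<le> 3 * \<delta>)"

section \<open>Preservation of the invariant when an item arrives\<close>

lemma stored_item_insert:
  "stored_item X c e \<Longrightarrow> stored_item (insert x X) c e"
  "stored_item (insert x X) (point x) (expir x)"
  by (auto simp: stored_item_def)

lemma sound_alarm_insert: "sound_alarm d \<gamma> X s \<Longrightarrow> sound_alarm d \<gamma> (insert x X) s"
  by (auto simp: sound_alarm_def)

text \<open>The new item and the stored one form a far pair that lasts until the first of them
  expires. The maximum of two sound alarms is one of the two.\<close>

lemma sound_alarm_max:
  assumes "sound_alarm d \<gamma> X s" and "stored_item X c e"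
    and "\<gamma> \<le> d (point x) c"
  shows "sound_alarm d \<gamma> (insert x X) (max s (min (expir x) e))"
proof -
  have "sound_alarm d \<gamma> (insert x X) (min (expir x) e)"
    using assms(2,3) unfolding sound_alarm_def stored_item_def by blast
  then show ?thesis
    using sound_alarm_insert[OF assms(1)] by (simp add: max_def)
qed

lemma (in Metric_space) summarizes_start:
  assumes "point x \<in> M" and "0 \<le> \<delta>"
  shows "summarizes d \<gamma> \<delta> {x} (start x)"
  using assms by (simp add: summarizes_def stored_item_def sound_alarm_def)

text \<open>Only pairs containing \<open>x\<close> are new. If \<open>x\<close> survives, it is
  within \<delta> of \<open>c\<close>, and every other survivor is within 2\<delta> of
  \<open>c\<close>, so the triangle inequality gives 3\<delta>. The hypotheses on old items refer to
  the new centre and alarm, so that the rule serves every branch of \<open>step\<close>.\<close>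

lemma (in Metric_space) summarizes_insertI:
  assumes X: "\<And>p. p \<in> X \<Longrightarrow> point p \<in> M" and x: "point x \<in> M" and "c \<in> M" and "0 \<le> \<delta>"
    and "stored_item (insert x X) c ec" and "stored_item (insert x X) m em"
    and "\<And>p. p \<in> insert x X \<Longrightarrow> expir p \<le> em" and "sound_alarm d \<gamma> (insert x X) s"
    and two: "\<And>p. p \<in> X \<Longrightarrow> s < expir p \<Longrightarrow> d (point p) c \<le> 2 * \<delta>"
    and one: "\<And>p. p \<in> X \<Longrightarrow> s < expir p \<Longrightarrow> ec < expir p \<Longrightarrow> d (point p) c \<le> \<delta>"
    and three: "\<And>p q. p \<in> X \<Longrightarrow> q \<in> X \<Longrightarrow> s < expir p \<Longrightarrow> s < expir q \<Longrightarrow>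
      d (point p) (point q) \<le> 3 * \<delta>"
    and xc: "s < expir x \<Longrightarrow> d (point x) c \<le> \<delta>"
  shows "summarizes d \<gamma> \<delta> (insert x X) (Summary c ec m em s)"
proof -
  have cross: "d (point x) (point p) \<le> 3 * \<delta>" "d (point p) (point x) \<le> 3 * \<delta>"
    if "p \<in> X" "s < expir p" "s < expir x" for p
    using triangle[OF x \<open>c \<in> M\<close> X[OF that(1)]] two[OF that(1,2)] xc[OF that(3)]
      commute[of c "point p"] commute[of "point p" "point x"]
    by linarith+
  have "d (point x) (point x) \<le> 3 * \<delta>"
    using x \<open>0 \<le> \<delta>\<close> by simp
  then have "\<forall>p\<in>insert x X. \<forall>q\<in>insert x X. s < expir p \<and> s < expir q \<longrightarrow>
      d (point p) (point q) \<le> 3 * \<delta>"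
    using cross three by blast
  moreover have "d (point p) c \<le> 2 * \<delta> \<and> (expir p \<le> ec \<or> d (point p) c \<le> \<delta>)"
    if "p \<in> insert x X" "s < expir p" for p
  proof (cases "p = x")
    case True
    then show ?thesis
      using xc that(2) \<open>0 \<le> \<delta>\<close> by auto
  next
    case False
    then show ?thesis
      using two[of p] one[of p] that by (cases "ec < expir p") (auto simp: not_less)
  qed
  ultimately show ?thesis
    using assms(5-8) by (simp add: summarizes_def)
qed

lemma (in Metric_space) summarizes_step:
  assumes "\<And>x y. x \<in> M \<Longrightarrow> y \<in> M \<Longrightarrow> d x y < \<gamma> \<Longrightarrow> d x y \<le> \<delta>" and "0 \<le> \<delta>"
    and X: "\<And>p. p \<in> X \<Longrightarrow> point p \<in> M" and x: "point x \<in> M"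
    and S: "summarizes d \<gamma> \<delta> X S"
  shows "summarizes d \<gamma> \<delta> (insert x X) (step d \<gamma> x S)"
proof (cases S)
  case S_eq: (Summary c ec m em s)
  have cM: "c \<in> M" and mM: "m \<in> M"
    using S X by (auto simp: S_eq summarizes_def stored_item_def)
  have c: "stored_item X c ec" and m: "stored_item X m em"
    and last: "\<And>p. p \<in> X \<Longrightarrow> expir p \<le> em"
    and s: "sound_alarm d \<gamma> X s"
    and two: "\<And>p. p \<in> X \<Longrightarrow> s < expir p \<Longrightarrow> d (point p) c \<le> 2 * \<delta>"
    and one: "\<And>p. p \<in> X \<Longrightarrow> s < expir p \<Longrightarrow> ec < expir p \<Longrightarrow> d (point p) c \<le> \<delta>"
    and three: "\<And>p q. p \<in> X \<Longrightarrow> q \<in> X \<Longrightarrow> s < expir p \<Longrightarrow> s < expir q \<Longrightarrow>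
      d (point p) (point q) \<le> 3 * \<delta>"
    using S by (auto simp: S_eq summarizes_def not_less[symmetric])
  have ecem: "ec \<le> em"
    using c last by (auto simp: stored_item_def)
  define m' where "m' = (if em < expir x then point x else m)"
  define em' where "em' = (if em < expir x then expir x else em)"
  have m': "stored_item (insert x X) m' em'"
    using m by (simp add: m'_def em'_def stored_item_insert)
  have last': "\<And>p. p \<in> insert x X \<Longrightarrow> expir p \<le> em'"
    using last by (fastforce simp: em'_def intro: order.trans less_imp_le)
  have step: "step d \<gamma> x S =
     (if d (point x) c < \<gamma> then Summary c ec m' em' s
      else if expir x \<le> ec \<or> (\<gamma> \<le> d (point x) m \<and> expir x \<le> em)
        then Summary c ec m em (max s (expir x))
      else if d (point x) m < \<gamma> then Summary m em m' em' (max s ec)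
      else Summary (point x) (expir x) (point x) (expir x) (max s em))"
    by (auto simp: S_eq m'_def em'_def)
  consider (near) "d (point x) c < \<gamma>"
    | (short) "\<gamma> \<le> d (point x) c" "expir x \<le> ec \<or> (\<gamma> \<le> d (point x) m \<and> expir x \<le> em)"
    | (recentre) "\<gamma> \<le> d (point x) c" "ec < expir x" "d (point x) m < \<gamma>"
    | (restart) "\<gamma> \<le> d (point x) c" "em < expir x" "\<gamma> \<le> d (point x) m"
    by fastforce
  then show ?thesis
  proof cases
    case near
    have eq: "step d \<gamma> x S = Summary c ec m' em' s"
      using near by (simp add: step)
    show ?thesis
      unfolding eq
      by (rule summarizes_insertI[OF X x cM \<open>0 \<le> \<delta>\<close> stored_item_insert(1)[OF c] m' last'
            sound_alarm_insert[OF s] two one three assms(1)[OF x cM near]])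
  next
    \<comment> \<open>The far partner of \<open>x\<close>, either \<open>c\<close> or
      \<open>m\<close>, expires no earlier than \<open>x\<close>, so \<open>expir x\<close> is a
      sound alarm. As \<open>x\<close> does not survive it, the centre can stay.\<close>
    case short
    have "sound_alarm d \<gamma> (insert x X) (max s (expir x))"
    proof (cases "expir x \<le> ec")
      case True
      then show ?thesis
        using sound_alarm_max[OF s c short(1)] by simp
    next
      case False
      then have "\<gamma> \<le> d (point x) m" "expir x \<le> em"
        using short(2) by auto
      then show ?thesis
        using sound_alarm_max[OF s m] by (metis min.absorb1)
    qed
    moreover have "expir p \<le> em" if "p \<in> insert x X" for p
      using that last short(2) ecem by auto
    moreover have eq: "step d \<gamma> x S = Summary c ec m em (max s (expir x))"
      using short by (simp add: step)
    ultimately show ?thesis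
      unfolding eq
      by (intro summarizes_insertI X x cM \<open>0 \<le> \<delta>\<close> stored_item_insert(1) c m)
        (use two one three in auto)
  next
    case recentre
    have alarm: "sound_alarm d \<gamma> (insert x X) (max s ec)"
      using sound_alarm_max[OF s c recentre(1)] recentre(2) by simp
    \<comment> \<open>Survivors of the new alarm outlast \<open>c\<close>, which leaves only the
      second alternative of the invariant.\<close>
    have pc: "d (point p) c \<le> \<delta>" if "p \<in> X" "max s ec < expir p" for p
      using one that by simp
    \<comment> \<open>The item at \<open>m\<close> expires no earlier than \<open>p\<close>, so it
      survives as well and is also near \<open>c\<close>. The detour through \<open>c\<close> costs
      2\<delta>.\<close>
    have pm: "d (point p) m \<le> 2 * \<delta>" if p: "p \<in> X" "max s ec < expir p" for p
    proof -
      obtain b where b: "b \<in> X" "point b = m" "expir b = em"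
        using m by (auto simp: stored_item_def)
      have "d m c \<le> \<delta>"
        using pc[OF b(1)] b p last[OF p(1)] by (auto intro: less_le_trans)
      then show ?thesis
        using triangle[OF X[OF p(1)] cM mM] pc[OF p] commute[of c m] by linarith
    qed
    have eq: "step d \<gamma> x S = Summary m em m' em' (max s ec)"
      using recentre ecem by (auto simp: step)
    show ?thesis
      unfolding eq
    proof (rule summarizes_insertI[OF X x mM \<open>0 \<le> \<delta>\<close> stored_item_insert(1)[OF m] m' last' alarm pm
            _ _ assms(1)[OF x mM recentre(3)]])
      \<comment> \<open>Vacuous, since no earlier item outlasts \<open>em\<close>.\<close>
      show "d (point p) m \<le> \<delta>" if "p \<in> X" "em < expir p" for p
        using last that by (meson leD)
      show "d (point p) (point q) \<le> 3 * \<delta>"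
        if "p \<in> X" "q \<in> X" "max s ec < expir p" "max s ec < expir q" for p q
        using three that by simp
    qed
  next
    \<comment> \<open>The far partner is \<open>m\<close>, which expires before \<open>x\<close>.
      All earlier items are gone at \<open>em\<close>, so only \<open>x\<close> can survive the new
      alarm.\<close>
    case restart
    have eq: "step d \<gamma> x S = Summary (point x) (expir x) (point x) (expir x) (max s em)"
      using restart ecem by (auto simp: step)
    have alarm: "sound_alarm d \<gamma> (insert x X) (max s em)"
      using sound_alarm_max[OF s m restart(3)] restart(2) by simp
    have gone: "\<not> max s em < expir p" if "p \<in> X" for p
      using last[OF that] by auto
    have "expir p \<le> expir x" if "p \<in> insert x X" for p
      using that last[of p] restart(2) by auto
    then show ?thesis
      unfolding eq
      by (intro summarizes_insertI X x \<open>0 \<le> \<delta>\<close> stored_item_insert(2) alarm)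
        (use gone x \<open>0 \<le> \<delta>\<close> in auto)
  qed
qed

section \<open>The summary of a whole stream\<close>

text \<open>A summary needs a first item. The value on the empty stream is arbitrary; the algorithm
  stores nothing then.\<close>

definition run :: "('a \<Rightarrow> 'a \<Rightarrow> real) \<Rightarrow> real \<Rightarrow> 'a item list \<Rightarrow> 'a summary" where
  "run d \<gamma> xs = fold (step d \<gamma>) (tl xs) (start (hd xs))"

lemma run_snoc: "xs \<noteq> [] \<Longrightarrow> run d \<gamma> (xs @ [x]) = step d \<gamma> x (run d \<gamma> xs)"
  by (simp add: run_def)

lemma (in Metric_space) summarizes_run:
  assumes "\<And>x y. x \<in> M \<Longrightarrow> y \<in> M \<Longrightarrow> d x y < \<gamma> \<Longrightarrow> d x y \<le> \<delta>" and "0 \<le> \<delta>"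
    and "xs \<noteq> []" and "point ` set xs \<subseteq> M"
  shows "summarizes d \<gamma> \<delta> (set xs) (run d \<gamma> xs)"
  using assms(3,4)
proof (induction xs rule: rev_nonempty_induct)
  case (single x)
  then show ?case
    using summarizes_start assms(2) by (simp add: run_def del: start.simps)
next
  case (snoc x xs)
  then have "summarizes d \<gamma> \<delta> (insert x (set xs)) (step d \<gamma> x (run d \<gamma> xs))"
    by (intro summarizes_step assms(1,2)) auto
  then show ?case
    using snoc.hyps by (simp add: run_snoc)
qed

section \<open>Storage in words and the algorithm for a list of thresholds\<close>

fun encode_summary :: "'a summary \<Rightarrow> 'a mword list" where
  "encode_summary (Summary c ec m em s) = [Point c, Time ec, Point m, Time em, Time s]"

fun decode :: "'a mword list \<Rightarrow> 'a summary list" where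
  "decode (Point c # Time ec # Point m # Time em # Time s # ws) = Summary c ec m em s # decode ws"
| "decode _ = []"

definition encode :: "'a summary list \<Rightarrow> 'a mword list" where
  "encode Ss = concat (map encode_summary Ss)"

lemma decode_encode [simp]: "decode (encode Ss) = Ss"
proof (induction Ss)
  case (Cons S Ss)
  then show ?case
    by (cases S) (simp add: encode_def)
qed (simp add: encode_def)

lemma length_encode [simp]: "length (encode Ss) = 5 * length Ss"
proof (induction Ss)
  case (Cons S Ss)
  then show ?case
    by (cases S) (simp add: encode_def)
qed (simp add: encode_def)

lemma encode_eq_Nil_iff [simp]: "encode Ss = [] \<longleftrightarrow> Ss = []"
  using length_encode[of Ss] by (metis length_0_conv mult_is_0 zero_neq_numeral)

text \<open>The thresholds belong to the program, not to the memory, so each one costs five words.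
  Empty memory marks that no item has arrived; for nonempty \<open>\<gamma>s\<close> this is
  unambiguous. The inserted 0 is the answer when all alarms have passed.\<close>

definition diam_alg :: "('a \<Rightarrow> 'a \<Rightarrow> real) \<Rightarrow> real list \<Rightarrow> 'a streaming_alg" where
  "diam_alg d \<gamma>s = \<lparr>init = [],
     update = (\<lambda>x ws. encode (if ws = [] then map (\<lambda>_. start x) \<gamma>s
                              else map2 (\<lambda>\<gamma>. step d \<gamma> x) \<gamma>s (decode ws))),
     query = (\<lambda>t ws. Max (insert 0 {\<gamma>. \<exists>S. (\<gamma>, S) \<in> set (zip \<gamma>s (decode ws)) \<and> ereal t < alarm S}))\<rparr>"

lemma memory_diam_alg:
  assumes "\<gamma>s \<noteq> []"
  shows "memory (diam_alg d \<gamma>s) xs = (if xs = [] then [] else encode (map (\<lambda>\<gamma>. run d \<gamma> xs) \<gamma>s))"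
proof (induction xs rule: rev_induct)
  case Nil
  then show ?case
    by (simp add: memory_def diam_alg_def)
next
  case (snoc x xs)
  have "memory (diam_alg d \<gamma>s) (xs @ [x]) =
      update (diam_alg d \<gamma>s) x (memory (diam_alg d \<gamma>s) xs)"
    by (simp add: memory_def)
  also have "\<dots> = encode (map (\<lambda>\<gamma>. run d \<gamma> (xs @ [x])) \<gamma>s)"
  proof (cases "xs = []")
    case True
    then show ?thesis
      using snoc by (simp add: diam_alg_def run_def)
  next
    case False
    then show ?thesis
      using snoc assms by (simp add: diam_alg_def run_snoc map2_map_map[where f = id, simplified])
  qed
  finally show ?case
    by simp
qed

lemma answer_diam_alg:
  assumes "\<gamma>s \<noteq> []" and "ys = filter (\<lambda>x. of_int (ins x) \<le> t) xs"
  shows "answer (diam_alg d \<gamma>s) xs t =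
    Max (insert 0 {\<gamma> \<in> set \<gamma>s. ys \<noteq> [] \<and> ereal t < alarm (run d \<gamma> ys)})"
proof -
  have "(\<gamma>, S) \<in> set (zip \<gamma>s (map (\<lambda>\<gamma>. run d \<gamma> ys) \<gamma>s)) \<longleftrightarrow> \<gamma> \<in> set \<gamma>s \<and> S = run d \<gamma> ys" for \<gamma> S
    by (auto simp: zip_map2 zip_same_conv_map)
  then show ?thesis
    unfolding answer_def assms(2)[symmetric] memory_diam_alg[OF assms(1)]
    by (auto simp: diam_alg_def intro!: arg_cong[where f = Max])
qed

text \<open>By the invariant, the stored points come from items and all times, including the alarm,
  are insertion or expiration times. There are no counters, so every exponent \<open>c\<close>
  works.\<close>

lemma storable_encode_run:
  assumes "\<And>\<gamma>. \<gamma> \<in> set \<gamma>s \<Longrightarrow> \<exists>\<delta>. summarizes d \<gamma> \<delta> (set xs) (run d \<gamma> xs)"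
    and "w \<in> set (encode (map (\<lambda>\<gamma>. run d \<gamma> xs) \<gamma>s))"
  shows "storable c xs w"
proof -
  obtain \<gamma> where \<gamma>: "\<gamma> \<in> set \<gamma>s" "w \<in> set (encode_summary (run d \<gamma> xs))"
    using assms(2) by (auto simp: encode_def)
  obtain \<delta> where S: "summarizes d \<gamma> \<delta> (set xs) (run d \<gamma> xs)"
    using assms(1) \<gamma>(1) by blast
  obtain p ep m em s where R: "run d \<gamma> xs = Summary p ep m em s"
    by (cases "run d \<gamma> xs")
  have "s \<in> (\<lambda>x. ereal (of_int (ins x))) ` set xs \<union> expir ` set xs"
    using S R by (auto simp: summarizes_def sound_alarm_def min_def)
  then show ?thesis
    using S \<gamma>(2) R by (auto simp: summarizes_def stored_item_def)
qed

section \<open>What an alarm says about the diameter\<close>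

lemma finite_active_points: "finite (active_points xs t)"
  by (simp add: active_points_def)

lemma finite_distances: "finite X \<Longrightarrow> finite {d x y | x y. x \<in> X \<and> y \<in> X}"
  using finite_image_set2[of "\<lambda>x. x \<in> X" "\<lambda>y. y \<in> X" d] by simp

lemma le_diam: "finite X \<Longrightarrow> x \<in> X \<Longrightarrow> y \<in> X \<Longrightarrow> d x y \<le> diam d X"
  unfolding diam_def using finite_distances[of X d] by (auto intro!: Max_ge)

lemma diam_le:
  assumes "finite X" and "0 \<le> B" and "\<And>x y. x \<in> X \<Longrightarrow> y \<in> X \<Longrightarrow> d x y \<le> B"
  shows "diam d X \<le> B"
proof (cases "X = {}")
  case False
  then have "Max {d x y | x y. x \<in> X \<and> y \<in> X} \<le> B"
    using finite_distances[OF assms(1), of d] assms(3)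
    by (intro Max.boundedI) blast+
  then show ?thesis
    using False by (simp add: diam_def)
qed (use assms(2) in \<open>simp add: diam_def\<close>)

lemma (in Metric_space) diam_nonneg:
  assumes "finite X"
  shows "0 \<le> diam d X"
proof (cases "X = {}")
  case False
  then obtain x where "x \<in> X"
    by blast
  then show ?thesis
    using le_diam[OF assms, of x x d] nonneg[of x x] by linarith
qed (simp add: diam_def)

text \<open>An alarm still ahead of \<open>t\<close> is no insertion time, so it is witnessed by a
  far pair, both of whose items are active.\<close>

lemma diam_active_ge:
  assumes "summarizes d \<gamma> \<delta> (set xs) S" and "\<forall>x\<in>set xs. of_int (ins x) \<le> t"
    and "ereal t < alarm S"
  shows "\<gamma> \<le> diam d (active_points xs t)"
proof -
  have "alarm S \<notin> (\<lambda>x. ereal (of_int (ins x))) ` set xs"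
    using assms(2,3) by auto
  then obtain p q where pq: "p \<in> set xs" "q \<in> set xs" "\<gamma> \<le> d (point p) (point q)"
    "alarm S = min (expir p) (expir q)"
    using assms(1) by (auto simp: summarizes_def sound_alarm_def)
  then have "point p \<in> active_points xs t" "point q \<in> active_points xs t"
    using assms(2,3) by (auto simp: active_points_def is_active_def)
  then show ?thesis
    using le_diam[OF finite_active_points] pq(3) by (meson order.trans)
qed

text \<open>When the alarm has passed, every active item outlives it, so the pairwise bound of the
  invariant applies.\<close>

lemma diam_active_le:
  assumes "summarizes d \<gamma> \<delta> (set xs) S" and "0 \<le> \<delta>" and "\<not> ereal t < alarm S"
  shows "diam d (active_points xs t) \<le> 3 * \<delta>"
proof (rule diam_le[OF finite_active_points])
  fix x y
  assume "x \<in> active_points xs t" "y \<in> active_points xs t"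
  then obtain p q where "p \<in> set xs" "q \<in> set xs" "x = point p" "y = point q"
    "ereal t < expir p" "ereal t < expir q"
    by (auto simp: active_points_def is_active_def)
  moreover from this have "alarm S < expir p" "alarm S < expir q"
    using assms(3) by auto
  ultimately show "d x y \<le> 3 * \<delta>"
    using assms(1) by (auto simp: summarizes_def)
qed (use assms(2) in simp)

lemma valid_stream_filter: "valid_stream M xs \<Longrightarrow> valid_stream M (filter P xs)"
  by (auto simp: valid_stream_def sorted_filter)

lemma active_points_filter:
  "active_points (filter (\<lambda>x. of_int (ins x) \<le> t) xs) t = active_points xs t"
  by (auto simp: active_points_def is_active_def)

section \<open>Geometric thresholds and the approximation ratio\<close>

definition scales :: "real \<Rightarrow> nat \<Rightarrow> real list" where
  "scales b k = map (\<lambda>i. b ^ i) [0..<k]"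

lemma set_scales: "set (scales b k) = {b ^ i | i. i < k}"
  by (auto simp: scales_def)

text \<open>The answer \<open>r\<close> is the largest threshold whose alarm is ahead, so it bounds
  the diameter from below. The alarm of the next threshold \<open>b * r\<close> has passed, which
  bounds the diameter by \<open>3 * (b * r)\<close>. The two ends of the list are treated
  separately.\<close>

lemma (in Metric_space) maintains_diameter_approx_diam_alg:
  assumes dist: "\<And>x y. x \<in> M \<Longrightarrow> y \<in> M \<Longrightarrow> x \<noteq> y \<Longrightarrow> d x y \<in> {1..\<Delta>}"
    and b: "1 < b" and k: "0 < k" "\<Delta> \<le> b ^ k" and \<alpha>: "3 * b \<le> \<alpha>"
  shows "maintains_diameter_approx M d \<alpha> (diam_alg d (scales b k))"
  unfolding maintains_diameter_approx_def
proof (intro allI impI)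
  fix xs :: "'a item list" and t :: real
  assume xs: "valid_stream M xs"
  define ys where "ys = filter (\<lambda>x. of_int (ins x) \<le> t) xs"
  let ?D = "diam d (active_points xs t)"
  let ?R = "{\<gamma> \<in> set (scales b k). ys \<noteq> [] \<and> ereal t < alarm (run d \<gamma> ys)}"
  define r where "r = Max (insert 0 ?R)"
  have ans: "answer (diam_alg d (scales b k)) xs t = r"
    unfolding r_def using k(1) by (intro answer_diam_alg ys_def) (auto simp: scales_def)
  have D: "?D = diam d (active_points ys t)"
    by (simp add: ys_def active_points_filter)
  have ysM: "point ` set ys \<subseteq> M"
    using xs by (auto simp: ys_def valid_stream_def)
  have ins: "\<forall>x\<in>set ys. of_int (ins x) \<le> t"
    by (simp add: ys_def)
  have run: "summarizes d \<gamma> \<delta> (set ys) (run d \<gamma> ys)"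
    if "ys \<noteq> []" "0 \<le> \<delta>" "\<And>x y. x \<in> M \<Longrightarrow> y \<in> M \<Longrightarrow> d x y < \<gamma> \<Longrightarrow> d x y \<le> \<delta>" for \<gamma> \<delta>
    using summarizes_run that ysM by blast
  have r: "r \<in> insert 0 ?R" and r_max: "\<And>\<gamma>. \<gamma> \<in> ?R \<Longrightarrow> \<gamma> \<le> r"
    unfolding r_def by (rule Max_in, simp_all)
  have "\<gamma> \<le> ?D" if "\<gamma> \<in> ?R" for \<gamma>
  proof -
    have "0 \<le> \<gamma>"
      using that b by (auto simp: set_scales)
    then have "summarizes d \<gamma> \<gamma> (set ys) (run d \<gamma> ys)"
      using that by (intro run) auto
    then show ?thesis
      using diam_active_ge ins that by (fastforce simp: D)
  qed
  then have "r \<le> ?D"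
    using r diam_nonneg[OF finite_active_points, of xs t] by auto
  moreover have "?D \<le> \<alpha> * r"
  proof (cases "ys = []")
    case True
    then have "?D = 0"
      unfolding D by (simp add: active_points_def diam_def)
    moreover have "r = 0"
      using True by (simp add: r_def)
    ultimately show ?thesis
      by simp
  next
    case False
    show ?thesis
    proof (cases "r = 0")
      \<comment> \<open>Even the alarm of scale 1 has passed. Distances below 1 vanish, so \<delta>
        = 0 is allowed there and the diameter is 0.\<close>
      case True
      have "1 \<in> set (scales b k)"
        using k(1) by (auto simp: set_scales intro: exI[of _ 0])
      then have "\<not> ereal t < alarm (run d 1 ys)"
        using r_max[of 1] True False by auto
      moreover have "summarizes d 1 0 (set ys) (run d 1 ys)"
      proof (rule run[OF False])
        fix x y
        assume "x \<in> M" "y \<in> M" "d x y < 1"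
        then show "d x y \<le> 0"
          using dist[of x y] by (cases "x = y") auto
      qed simp
      ultimately show ?thesis
        using diam_active_le[of d 1 0 ys "run d 1 ys" t] True by (simp add: D)
    next
      case r0: False
      then obtain i where i: "r = b ^ i" "i < k"
        using r by (auto simp: set_scales)
      have rpos: "0 < r"
        using i b by simp
      have "?D \<le> 3 * (b * r)"
      proof (cases "Suc i < k")
        case True
        have "b * r \<in> set (scales b k)"
          using True by (auto simp: set_scales i(1) intro!: exI[of _ "Suc i"])
        moreover have "\<not> b * r \<le> r"
          using b rpos by simp
        ultimately have "\<not> ereal t < alarm (run d (b * r) ys)"
          using r_max[of "b * r"] False by auto
        moreover have "0 \<le> b * r"
          using b rpos by simp
        moreover from this have "summarizes d (b * r) (b * r) (set ys) (run d (b * r) ys)"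
          by (intro run False) auto
        ultimately show ?thesis
          using diam_active_le D by metis
      next
        \<comment> \<open>At the top scale, \<open>\<Delta> \<le> b ^ k = b * r\<close> replaces the
          missing next threshold.\<close>
        case False
        then have "k = Suc i"
          using i(2) by simp
        then have "\<Delta> \<le> b * r" "0 \<le> b * r"
          using k(2) i(1) b rpos by auto
        moreover have "active_points ys t \<subseteq> M"
          using ysM by (auto simp: active_points_def)
        ultimately have "?D \<le> b * r"
          unfolding D using dist
          by (intro diam_le[OF finite_active_points]) (metis atLeastAtMost_iff mdist_zero
              order.trans subsetD)+
        then show ?thesis
          using \<open>0 \<le> b * r\<close> by linarith
      qed
      also have "\<dots> \<le> \<alpha> * r"
        using \<alpha> rpos by simp
      finally show ?thesis .
    qed
  qed
  ultimately show "answer (diam_alg d (scales b k)) xs t \<le> ?D \<and>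
      ?D \<le> \<alpha> * answer (diam_alg d (scales b k)) xs t"
    by (simp add: ans)
qed

section \<open>Space and the choice of constants\<close>

lemma (in Metric_space) uses_at_most_words_diam_alg:
  assumes "1 < b" and "0 < k" and "5 * real k \<le> B"
  shows "uses_at_most_words M c B (diam_alg d (scales b k))"
  unfolding uses_at_most_words_def
proof (intro allI impI)
  fix xs :: "'a item list"
  assume xs: "valid_stream M xs"
  have mem: "memory (diam_alg d (scales b k)) xs =
      (if xs = [] then [] else encode (map (\<lambda>\<gamma>. run d \<gamma> xs) (scales b k)))"
    using assms(2) by (intro memory_diam_alg) (simp add: scales_def)
  show "real (length (memory (diam_alg d (scales b k)) xs)) \<le> B \<and>
      (\<forall>w\<in>set (memory (diam_alg d (scales b k)) xs). storable c xs w)"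
  proof (cases "xs = []")
    case True
    then show ?thesis
      using assms(3) mem by simp
  next
    case False
    have "\<exists>\<delta>. summarizes d \<gamma> \<delta> (set xs) (run d \<gamma> xs)" if "\<gamma> \<in> set (scales b k)" for \<gamma>
      using that assms(1) xs False
      by (intro exI[of _ \<gamma>] summarizes_run) (auto simp: set_scales valid_stream_def)
    then show ?thesis
      using False assms(3) storable_encode_run[of "scales b k" d xs] mem
      by (simp add: scales_def)
  qed
qed

text \<open>The base satisfies \<open>3 * (1 + min 1 \<epsilon> / 3) \<le> 3 + \<epsilon>\<close>,
  and \<open>k\<close> exceeds the logarithm of \<Delta> to this base by at most 1.\<close>

lemma number_of_scales:
  assumes "1 \<le> \<Delta>" and "0 < \<epsilon>"
  obtains k where "0 < k" and "\<Delta> \<le> (1 + min 1 \<epsilon> / 3) ^ k" and "real k \<le> 7 * space_bound \<epsilon> \<Delta>"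
proof
  define e where "e = min 1 \<epsilon> / 3"
  have e: "0 < e" "e \<le> 1 / 3"
    using assms(2) by (auto simp: e_def)
  let ?q = "ln \<Delta> / ln (1 + e)"
  let ?k = "Suc (nat \<lfloor>?q\<rfloor>)"
  have ln\<Delta>: "0 \<le> ln \<Delta>"
    using assms(1) by simp
  \<comment> \<open>Since e is at most 1/2, this gives a lower bound for the logarithm that is
    linear in e.\<close>
  have "e / 2 \<le> e - e\<^sup>2"
    using mult_left_mono[of e "1/2" e] e by (simp add: power2_eq_square)
  also have "\<dots> \<le> ln (1 + e)"
    using e by (intro ln_one_plus_pos_lower_bound) auto
  finally have ln_e: "e / 2 \<le> ln (1 + e)" .
  have lnpos: "0 < ln (1 + e)"
    using e by simp
  have q: "0 \<le> ?q"
    using ln\<Delta> lnpos by simp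
  show "0 < ?k"
    by simp
  have "?q \<le> real ?k"
    using q by linarith
  then have "ln \<Delta> \<le> real ?k * ln (1 + e)"
    using lnpos by (simp add: pos_divide_le_eq)
  also have "\<dots> = ln ((1 + e) ^ ?k)"
    using e by (simp only: ln_realpow)
  finally show "\<Delta> \<le> (1 + min 1 \<epsilon> / 3) ^ ?k"
    using assms(1) e by (subst (asm) ln_le_cancel_iff) (auto simp: e_def)
  have "?q \<le> ln \<Delta> / (e / 2)"
    using ln_e ln\<Delta> e by (intro divide_left_mono) auto
  also have "\<dots> = 6 * (1 / min 1 \<epsilon> * ln \<Delta>)"
    by (simp add: e_def)
  also have "\<dots> \<le> 6 * space_bound \<epsilon> \<Delta>"
    by (simp add: space_bound_def)
  finally have "?q \<le> 6 * space_bound \<epsilon> \<Delta>" .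
  moreover have "1 \<le> space_bound \<epsilon> \<Delta>"
    by (simp add: space_bound_def)
  \<comment> \<open>The extra scale from \<open>Suc\<close> is absorbed by
    \<open>space_bound\<close>, which is at least 1; hence 7 instead of 6.\<close>
  ultimately show "real ?k \<le> 7 * space_bound \<epsilon> \<Delta>"
    using q by linarith
qed

theorem theorem1p1:
  shows "\<exists>(C::real) (c::nat). C > 0 \<and>
    (\<forall>(M::'a set) (d::'a \<Rightarrow> 'a \<Rightarrow> real) (\<Delta>::real) (\<epsilon>::real).
       Metric_space M d \<and> 1 \<le> \<Delta> \<and>
       (\<forall>x\<in>M. \<forall>y\<in>M. x \<noteq> y \<longrightarrow> d x y \<in> {1..\<Delta>}) \<and> 0 < \<epsilon> \<longrightarrow>
       (\<exists>A::'a streaming_alg.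
          uses_at_most_words M c (C * space_bound \<epsilon> \<Delta>) A \<and>
          maintains_diameter_approx M d (3 + \<epsilon>) A))"
\<comment> \<open>35 is five words per scale times the 7 of \<open>number_of_scales\<close>. The
  exponent 0 suffices as no counters are stored.\<close>
proof (rule exI[of _ 35], rule exI[of _ 0], intro conjI allI impI)
  fix M :: "'a set" and d :: "'a \<Rightarrow> 'a \<Rightarrow> real" and \<Delta> \<epsilon> :: real
  assume asm: "Metric_space M d \<and> 1 \<le> \<Delta> \<and>
    (\<forall>x\<in>M. \<forall>y\<in>M. x \<noteq> y \<longrightarrow> d x y \<in> {1..\<Delta>}) \<and> 0 < \<epsilon>"
  then interpret Metric_space M d
    by blast
  obtain k where k: "0 < k" "\<Delta> \<le> (1 + min 1 \<epsilon> / 3) ^ k" "real k \<le> 7 * space_bound \<epsilon> \<Delta>"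
    using number_of_scales asm by blast
  let ?A = "diam_alg d (scales (1 + min 1 \<epsilon> / 3) k)"
  have b: "1 < 1 + min 1 \<epsilon> / 3"
    using asm by simp
  have "uses_at_most_words M 0 (35 * space_bound \<epsilon> \<Delta>) ?A"
    using k b by (intro uses_at_most_words_diam_alg) auto
  moreover have "maintains_diameter_approx M d (3 + \<epsilon>) ?A"
    using asm k b by (intro maintains_diameter_approx_diam_alg[of \<Delta>]) auto
  ultimately show "\<exists>A. uses_at_most_words M 0 (35 * space_bound \<epsilon> \<Delta>) A \<and>
      maintains_diameter_approx M d (3 + \<epsilon>) A"
    by blast
qed simp

end
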